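(* Let $\mathcal D$ be a finite set with $T=|\mathcal D|\ge 1$, let $\mathcal Q$ be a nonempty finite family of functions with $k=|\mathcal Q|\ge 1$, let $n\ge 1$ be an integer, and suppose every $q\in\mathcal Q$ maps $\mathcal D$ to $[-1,1]$. For every real $\varepsilon>0$ there exists a randomized mechanism $M$, with inputs $x\in\mathcal D^n$ and output in $\mathbb R^{\mathcal Q}$, that is pure $\varepsilon$-differentially private and satisfies $$\sup_{x\in\mathcal D^n}\mathbb E\,\|M(x)-F(x)\|_\infty\le 129e\,\min\left\{1,\sqrt{\frac{\log(2T)\log(2k)}{\varepsilon n}}\right\}.$$
   Context: For $x=(x_1,\dots,x_n)\in\mathcal D^n$ and $q\in\mathcal Q$, put $F_q(x)=\frac1n\sum_{i=1}^n q(x_i)$ and $F(x)=(F_q(x))_{q\in\mathcal Q}\in\mathbb R^{\mathcal Q}$. Here $\|z\|_\infty=\max_{q\in\mathcal Q}|z_q|$, $\log$ is the natural logarithm, and $e$ is Euler's number. All probability spaces are finite: a randomized mechanism assigns to each $x\in\mathcal D^n$ a random output $M(x)$ whose law has finite support. Two databases $x,x'\in\mathcal D^n$ are neighboring if they differ in exactly one coordinate (Hamming distance one). The mechanism $M$ is pure $\varepsilon$-differentially private if for all neighboring $x,x'$ and every subset $E$ of its output space, $\mathbb P[M(x)\in E]\le e^{\varepsilon}\,\mathbb P[M(x')\in E]$. *)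

theory Defs
  imports "HOL-Probability.Probability"
begin

definition databases :: "nat \<Rightarrow> 'a set \<Rightarrow> (nat \<Rightarrow> 'a) set" where
  "databases n D = {1..n} \<rightarrow>\<^sub>E D"

definition neighboring :: "nat \<Rightarrow> (nat \<Rightarrow> 'a) \<Rightarrow> (nat \<Rightarrow> 'a) \<Rightarrow> bool" where
  "neighboring n x x' \<longleftrightarrow> card {i \<in> {1..n}. x i \<noteq> x' i} = 1"

text \<open>Vectors indexed by a set \<open>Q\<close> are functions that are \<open>undefined\<close> outside \<open>Q\<close>.\<close>

definition vectors :: "'q set \<Rightarrow> ('q \<Rightarrow> real) set" where
  "vectors Q = Q \<rightarrow>\<^sub>E UNIV"

text \<open>Only meaningful for finite nonempty \<open>Q\<close>.\<close>

definition max_norm :: "'q set \<Rightarrow> ('q \<Rightarrow> real) \<Rightarrow> real" where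
  "max_norm Q z = Max ((\<lambda>q. \<bar>z q\<bar>) ` Q)"

definition query_mean :: "nat \<Rightarrow> ('a \<Rightarrow> real) \<Rightarrow> (nat \<Rightarrow> 'a) \<Rightarrow> real" where
  "query_mean n q x = (1 / real n) * (\<Sum>i = 1..n. q (x i))"

definition query_answers ::
    "nat \<Rightarrow> ('a \<Rightarrow> real) set \<Rightarrow> (nat \<Rightarrow> 'a) \<Rightarrow> (('a \<Rightarrow> real) \<Rightarrow> real)" where
  "query_answers n Q x = (\<lambda>q\<in>Q. query_mean n q x)"

text \<open>A mechanism with output space \<open>Y\<close> is represented by the laws of its outputs.
  It is constrained only on the databases over \<open>D\<close>, where all laws have finite support.\<close>

definition randomized_mechanism ::
    "nat \<Rightarrow> 'a set \<Rightarrow> 'b set \<Rightarrow> ((nat \<Rightarrow> 'a) \<Rightarrow> 'b pmf) \<Rightarrow> bool" where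
  "randomized_mechanism n D Y M \<longleftrightarrow>
     (\<forall>x\<in>databases n D. finite (set_pmf (M x)) \<and> set_pmf (M x) \<subseteq> Y)"

definition pure_differentially_private ::
    "real \<Rightarrow> nat \<Rightarrow> 'a set \<Rightarrow> 'b set \<Rightarrow> ((nat \<Rightarrow> 'a) \<Rightarrow> 'b pmf) \<Rightarrow> bool" where
  "pure_differentially_private \<epsilon> n D Y M \<longleftrightarrow>
     (\<forall>x\<in>databases n D. \<forall>x'\<in>databases n D. neighboring n x x' \<longrightarrow>
        (\<forall>E\<subseteq>Y. measure_pmf.prob (M x) E \<le> exp \<epsilon> * measure_pmf.prob (M x') E))"

end

theory Submission imports Defs begin

text \<open>
  Close the queries under negation to a set \<open>J\<close>. For a histogram \<open>h\<close> consider \<open>m\<close> rounds of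
  the following game, without regard to privacy: sample a query \<open>q\<close> with probability proportional to
  \<open>exp (\<eta> * q \<bullet> (h - z))\<close>, where \<open>z\<close> is the current multiplicative weights guess for \<open>h\<close>.
  Let \<open>K h y\<close> be the probability of the transcript \<open>y\<close>. The mechanism samples \<open>y\<close> with probability
  proportional to \<open>max\<^sub>x\<^sub>' exp (- \<epsilon> d(x, x') / 2) K (hist x') y\<close>, with \<open>d\<close> the Hamming
  distance, and answers with the average guess. It is private because this weight
  changes by a factor of at most \<open>exp (\<epsilon> / 2)\<close> between neighbours.

  For the accuracy two things are needed. By the regret bound of multiplicative weights, \<open>K h y\<close> is tiny
  if the average guess of \<open>y\<close> is far from \<open>h\<close>. Moreover, the sum over \<open>y\<close> of the maximum
  of \<open>K (hist x') y\<close> over the Hamming ball of radius \<open>r\<close> around \<open>x\<close> is at most \<open>exp (\<epsilon> r / 8)\<close>,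
  which is beaten by the penalty. Such a sum is the exponential of a minimax regret
  for the logarithmic loss. Each round is an exponential family in \<open>h\<close>, so this loss is convex in \<open>h\<close>, and
  running multiplicative weights over perturbations of \<open>hist x\<close> yields a
  sequential predictor whose regret is of order \<open>\<eta> (r / n) sqrt (m ln T)\<close>.
\<close>

section \<open>Exponential weights\<close>

text \<open>The Gibbs (softmax) distribution. It serves as the guess over \<open>D\<close>, as the
  sampling law over \<open>J\<close>, and inside the online learner that dominates the
  likelihoods.\<close>

definition exp_weights :: "'s set \<Rightarrow> real \<Rightarrow> ('s \<Rightarrow> real) \<Rightarrow> 's \<Rightarrow> real" where
  "exp_weights S \<gamma> w s = exp (\<gamma> * w s) / (\<Sum>r\<in>S. exp (\<gamma> * w r))"

lemma sum_exp_pos: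
  fixes f :: "'s \<Rightarrow> real"
  assumes "finite S" "S \<noteq> {}"
  shows "0 < (\<Sum>s\<in>S. exp (f s))"
  using assms by (intro sum_pos) auto

lemma exp_weights_pos:
  assumes "finite S" "S \<noteq> {}"
  shows "0 < exp_weights S \<gamma> w s"
  unfolding exp_weights_def using sum_exp_pos[OF assms] by (intro divide_pos_pos) auto

lemma sum_exp_weights:
  assumes "finite S" "S \<noteq> {}"
  shows "(\<Sum>s\<in>S. exp_weights S \<gamma> w s) = 1"
  unfolding exp_weights_def sum_divide_distrib[symmetric]
  using sum_exp_pos[OF assms, of "\<lambda>s. \<gamma> * w s"] by simp

lemma abs_average_le:
  fixes p v :: "'s \<Rightarrow> real"
  assumes "(\<Sum>s\<in>S. p s) = 1" "\<And>s. s \<in> S \<Longrightarrow> 0 \<le> p s" "\<And>s. s \<in> S \<Longrightarrow> \<bar>v s\<bar> \<le> c"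
  shows "\<bar>\<Sum>s\<in>S. p s * v s\<bar> \<le> c"
proof -
  have "\<bar>\<Sum>s\<in>S. p s * v s\<bar> \<le> (\<Sum>s\<in>S. p s * c)"
    by (rule order_trans[OF sum_abs]) (intro sum_mono, simp add: abs_mult assms mult_left_mono)
  then show ?thesis by (simp add: sum_distrib_right[symmetric] assms(1))
qed

text \<open>Convexity of the log-partition function.\<close>

lemma exp_weights_le:
  assumes "finite S" "S \<noteq> {}"
  shows "exp_weights S \<eta> w s \<le> exp_weights S \<eta> w' s *
    exp (\<eta> * ((w s - w' s) - (\<Sum>r\<in>S. exp_weights S \<eta> w' r * (w r - w' r))))"
proof -
  let ?Z = "\<Sum>r\<in>S. exp (\<eta> * w r)" and ?Z' = "\<Sum>r\<in>S. exp (\<eta> * w' r)"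
  let ?\<mu> = "\<Sum>r\<in>S. exp_weights S \<eta> w' r * (w r - w' r)"
  have Z: "0 < ?Z" "0 < ?Z'" using sum_exp_pos[OF assms] by auto
  \<comment> \<open>Jensen's inequality by the tangent of exp at \<open>\<eta> * ?\<mu>\<close>:
    averaged under the weights for \<open>w'\<close>, the tangent gives its value at the mean, and
    it lies below exp.\<close>
  have "exp (\<eta> * ?\<mu>) = (\<Sum>r\<in>S. exp_weights S \<eta> w' r * (exp (\<eta> * ?\<mu>) * (1 + (\<eta> * (w r - w' r) - \<eta> * ?\<mu>))))"
  proof -
    define \<mu> where "\<mu> = ?\<mu>"
    have "(\<Sum>r\<in>S. exp_weights S \<eta> w' r * (exp (\<eta> * \<mu>) * (1 + (\<eta> * (w r - w' r) - \<eta> * \<mu>))))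
       = (\<Sum>r\<in>S. exp (\<eta> * \<mu>) * (1 - \<eta> * \<mu>) * exp_weights S \<eta> w' r
          + exp (\<eta> * \<mu>) * \<eta> * (exp_weights S \<eta> w' r * (w r - w' r)))"
      by (intro sum.cong refl) (simp add: algebra_simps)
    also have "\<dots> = exp (\<eta> * \<mu>) * (1 - \<eta> * \<mu>) * (\<Sum>r\<in>S. exp_weights S \<eta> w' r) + exp (\<eta> * \<mu>) * \<eta> * \<mu>"
      by (simp add: sum.distrib sum_distrib_left \<mu>_def)
    finally show ?thesis by (simp add: sum_exp_weights[OF assms] algebra_simps \<mu>_def)
  qed
  also have "\<dots> \<le> (\<Sum>r\<in>S. exp_weights S \<eta> w' r * exp (\<eta> * (w r - w' r)))"
  proof (intro sum_mono mult_left_mono)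
    fix r
    have "exp (\<eta> * ?\<mu>) * (1 + (\<eta> * (w r - w' r) - \<eta> * ?\<mu>))
        \<le> exp (\<eta> * ?\<mu>) * exp (\<eta> * (w r - w' r) - \<eta> * ?\<mu>)"
      by (intro mult_left_mono exp_ge_add_one_self) auto
    then show "exp (\<eta> * ?\<mu>) * (1 + (\<eta> * (w r - w' r) - \<eta> * ?\<mu>)) \<le> exp (\<eta> * (w r - w' r))"
      by (simp add: exp_add[symmetric])
  qed (use exp_weights_pos[OF assms] in \<open>auto intro: less_imp_le\<close>)
  also have "\<dots> = ?Z / ?Z'"
    by (simp add: exp_weights_def sum_divide_distrib exp_add[symmetric] algebra_simps)
  finally have "exp (\<eta> * ?\<mu>) * ?Z' \<le> ?Z" using Z by (simp add: field_simps)
  then have "1 / ?Z \<le> 1 / (exp (\<eta> * ?\<mu>) * ?Z')" using Z by (intro divide_left_mono) auto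
  then have "exp (\<eta> * w s) * (1 / ?Z) \<le> exp (\<eta> * w s) * (1 / (exp (\<eta> * ?\<mu>) * ?Z'))"
    by (intro mult_left_mono) auto
  also have "\<dots> = exp (\<eta> * w' s) / ?Z' * exp (\<eta> * ((w s - w' s) - ?\<mu>))"
    using Z by (simp add: exp_diff exp_add right_diff_distrib field_simps)
  finally show ?thesis by (simp add: exp_weights_def)
qed

section \<open>Regret of multiplicative weights\<close>

lemma exp_le_quadratic:
  fixes z :: real
  assumes "\<bar>z\<bar> \<le> 1"
  shows "exp z \<le> 1 + z + z\<^sup>2"
proof (cases "z \<ge> 0")
  case True
  then show ?thesis using assms exp_bound[of z] by auto
next
  case False
  have "1 + (-z) \<le> exp (-z)" using exp_ge_add_one_self[of "-z"] by simp
  then have "exp z \<le> 1 / (1 - z)" using False by (simp add: exp_minus field_simps)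
  also have "\<dots> \<le> 1 + z + z\<^sup>2"
  proof -
    \<comment> \<open>The product (1 + z + z^2) * (1 - z) equals 1 - z^3.\<close>
    have "z^3 \<le> 0" using False by (simp add: power3_eq_cube mult_nonneg_nonpos mult_nonpos_nonpos)
    then have "1 \<le> (1 + z + z\<^sup>2) * (1 - z)" by (simp add: algebra_simps power2_eq_square power3_eq_cube)
    then show ?thesis using False by (simp add: field_simps)
  qed
  finally show ?thesis .
qed

text \<open>One round of the potential argument: the partition function grows by the exponential of
  the learner's expected gain, up to a second-order term from
  \<open>exp_le_quadratic\<close>.\<close>

lemma sum_exp_step:
  assumes S: "finite S" "S \<noteq> {}" and v: "\<And>s. s \<in> S \<Longrightarrow> \<bar>v s\<bar> \<le> c"
    and \<gamma>: "0 \<le> \<gamma>" "\<gamma> * c \<le> 1"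
  shows "(\<Sum>s\<in>S. exp (\<gamma> * (L s + v s)))
    \<le> (\<Sum>s\<in>S. exp (\<gamma> * L s)) * exp (\<gamma> * (\<Sum>s\<in>S. exp_weights S \<gamma> L s * v s) + \<gamma>\<^sup>2 * c\<^sup>2)"
proof -
  let ?Z = "\<Sum>s\<in>S. exp (\<gamma> * L s)" and ?p = "exp_weights S \<gamma> L"
  have Z: "0 < ?Z" using sum_exp_pos[OF S] .
  have "(\<Sum>s\<in>S. exp (\<gamma> * (L s + v s))) = ?Z * (\<Sum>s\<in>S. ?p s * exp (\<gamma> * v s))"
    using Z by (simp add: exp_weights_def sum_distrib_left exp_add distrib_left)
  also have "\<dots> \<le> ?Z * (\<Sum>s\<in>S. ?p s * (1 + \<gamma> * v s + \<gamma>\<^sup>2 * c\<^sup>2))"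
  proof (intro mult_left_mono sum_mono)
    fix s assume s: "s \<in> S"
    have "\<bar>\<gamma> * v s\<bar> \<le> \<gamma> * c" using v[OF s] \<gamma> by (simp add: abs_mult mult_left_mono)
    then have "\<bar>\<gamma> * v s\<bar> \<le> 1" "(\<gamma> * v s)\<^sup>2 \<le> (\<gamma> * c)\<^sup>2"
      using \<gamma> by (auto simp: abs_le_square_iff[symmetric])
    then show "exp (\<gamma> * v s) \<le> 1 + \<gamma> * v s + \<gamma>\<^sup>2 * c\<^sup>2"
      using exp_le_quadratic[of "\<gamma> * v s"] by (simp add: power_mult_distrib)
  qed (use Z exp_weights_pos[OF S] in \<open>auto intro: less_imp_le\<close>)
  also have "(\<Sum>s\<in>S. ?p s * (1 + \<gamma> * v s + \<gamma>\<^sup>2 * c\<^sup>2))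
      = (\<Sum>s\<in>S. ?p s) * (1 + \<gamma>\<^sup>2 * c\<^sup>2) + \<gamma> * (\<Sum>s\<in>S. ?p s * v s)"
    by (simp add: sum_distrib_left sum_distrib_right sum.distrib[symmetric] algebra_simps)
  also have "\<dots> = 1 + (\<gamma> * (\<Sum>s\<in>S. ?p s * v s) + \<gamma>\<^sup>2 * c\<^sup>2)" by (simp add: sum_exp_weights[OF S])
  also have "?Z * \<dots> \<le> ?Z * exp (\<gamma> * (\<Sum>s\<in>S. ?p s * v s) + \<gamma>\<^sup>2 * c\<^sup>2)"
    using Z by (intro mult_left_mono exp_ge_add_one_self) auto
  finally show ?thesis .
qed

text \<open>Histories are lists with the most recent round at the head, so that the state of a strategy
  is a function of the tail.\<close>

primrec hedge_gain :: "'s set \<Rightarrow> real \<Rightarrow> ('b list \<Rightarrow> 's \<Rightarrow> real) \<Rightarrow> 'b list \<Rightarrow> real" where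
  "hedge_gain S \<gamma> G [] = 0"
| "hedge_gain S \<gamma> G (q # qs) =
     hedge_gain S \<gamma> G qs + (\<Sum>s\<in>S. exp_weights S \<gamma> (G qs) s * (G (q # qs) s - G qs s))"

text \<open>The partition function is at least its term for \<open>s\<close> and at most what
  iterating \<open>sum_exp_step\<close> gives. Cumulative gains are arbitrary functions of the
  history, so they may react to the learner's own earlier weights, as \<open>gradient\<close>
  does.\<close>

lemma hedge_regret:
  fixes G :: "'b list \<Rightarrow> 's \<Rightarrow> real" and \<gamma> c :: real
  assumes S: "finite S" "s \<in> S" and \<gamma>: "0 < \<gamma>" "\<gamma> * c \<le> 1"
    and G0: "\<And>r. G [] r = 0"
    and step: "\<And>r q qs. r \<in> S \<Longrightarrow> q \<in> J \<Longrightarrow> set qs \<subseteq> J \<Longrightarrow> \<bar>G (q # qs) r - G qs r\<bar> \<le> c"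
    and qs: "set qs \<subseteq> J"
  shows "G qs s \<le> hedge_gain S \<gamma> G qs + (ln (card S) / \<gamma> + \<gamma> * c\<^sup>2 * length qs)"
proof -
  have ne: "S \<noteq> {}" using S by auto
  have "(\<Sum>r\<in>S. exp (\<gamma> * G qs r)) \<le> card S * exp (\<gamma> * hedge_gain S \<gamma> G qs + \<gamma>\<^sup>2 * c\<^sup>2 * length qs)"
    using qs
  proof (induction qs)
    case Nil
    then show ?case by (simp add: G0)
  next
    case (Cons q qs)
    let ?v = "\<lambda>r. G (q # qs) r - G qs r"
    have "(\<Sum>r\<in>S. exp (\<gamma> * G (q # qs) r)) = (\<Sum>r\<in>S. exp (\<gamma> * (G qs r + ?v r)))" by simp
    also have "\<dots> \<le> (\<Sum>r\<in>S. exp (\<gamma> * G qs r)) *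
        exp (\<gamma> * (\<Sum>r\<in>S. exp_weights S \<gamma> (G qs) r * ?v r) + \<gamma>\<^sup>2 * c\<^sup>2)"
      using Cons.prems \<gamma> by (intro sum_exp_step S ne step) auto
    also have "\<dots> \<le> (card S * exp (\<gamma> * hedge_gain S \<gamma> G qs + \<gamma>\<^sup>2 * c\<^sup>2 * length qs)) *
        exp (\<gamma> * (\<Sum>r\<in>S. exp_weights S \<gamma> (G qs) r * ?v r) + \<gamma>\<^sup>2 * c\<^sup>2)"
      using Cons by (intro mult_right_mono) auto
    finally show ?case by (simp add: exp_add[symmetric] algebra_simps)
  qed
  moreover have "exp (\<gamma> * G qs s) \<le> (\<Sum>r\<in>S. exp (\<gamma> * G qs r))"
    using S by (intro member_le_sum) auto
  ultimately have "exp (\<gamma> * G qs s) \<le> card S * exp (\<gamma> * hedge_gain S \<gamma> G qs + \<gamma>\<^sup>2 * c\<^sup>2 * length qs)"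
    by linarith
  moreover have "0 < card S" using S by (auto simp: card_gt_0_iff)
  ultimately have "exp (\<gamma> * G qs s) \<le> exp (ln (card S) + (\<gamma> * hedge_gain S \<gamma> G qs + \<gamma>\<^sup>2 * c\<^sup>2 * length qs))"
    by (simp add: exp_add)
  then have "\<gamma> * G qs s \<le> \<gamma> * (hedge_gain S \<gamma> G qs + (ln (card S) / \<gamma> + \<gamma> * c\<^sup>2 * length qs))"
    using \<gamma> by (simp add: distrib_left power2_eq_square mult.assoc)
  then show ?thesis using \<gamma> by simp
qed

text \<open>The chain rule for conditional probabilities: the most recent round, at the head, is
  summed out first.\<close>

lemma sum_lists_sequential:
  fixes P :: "'b list \<Rightarrow> real"
  assumes "P [] = 1" "\<And>q qs. P (q # qs) = P qs * f qs q" "\<And>qs. (\<Sum>q\<in>J. f qs q) = 1"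
  shows "(\<Sum>qs | set qs \<subseteq> J \<and> length qs = m. P qs) = 1"
proof (induction m)
  case 0
  have "{qs. set qs \<subseteq> J \<and> length qs = 0} = {[]}" by auto
  then show ?case by (simp add: assms)
next
  case (Suc m)
  have "(\<Sum>qs | set qs \<subseteq> J \<and> length qs = Suc m. P qs)
      = (\<Sum>(qs, q) \<in> {qs. set qs \<subseteq> J \<and> length qs = m} \<times> J. P (q # qs))"
    unfolding lists_length_Suc_eq
    by (subst sum.reindex) (auto simp: inj_on_def intro!: sum.cong)
  also have "\<dots> = (\<Sum>qs | set qs \<subseteq> J \<and> length qs = m. P qs * (\<Sum>q\<in>J. f qs q))"
    by (simp add: sum.cartesian_product[symmetric] assms(2) sum_distrib_left)
  finally show ?case by (simp add: assms(3) Suc)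
qed

section \<open>Finite distributions and databases\<close>

definition weights_pmf :: "'s set \<Rightarrow> ('s \<Rightarrow> real) \<Rightarrow> 's pmf" where
  "weights_pmf S g = embed_pmf (\<lambda>s. if s \<in> S then g s / sum g S else 0)"

lemma pmf_weights_pmf:
  assumes "finite S" "S \<noteq> {}" "\<And>s. s \<in> S \<Longrightarrow> 0 < g s"
  shows "pmf (weights_pmf S g) s = (if s \<in> S then g s / sum g S else 0)"
proof -
  have pos: "0 < sum g S" using assms by (intro sum_pos)
  have "(\<integral>\<^sup>+ s. ennreal (if s \<in> S then g s / sum g S else 0) \<partial>count_space UNIV)
      = (\<integral>\<^sup>+ s. ennreal (g s / sum g S) * indicator S s \<partial>count_space UNIV)"
    by (intro nn_integral_cong) (auto simp: indicator_def)
  also have "\<dots> = (\<Sum>s\<in>S. ennreal (g s / sum g S))"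
    using assms by (simp add: nn_integral_count_space_indicator[symmetric] nn_integral_count_space_finite)
  also have "\<dots> = ennreal (\<Sum>s\<in>S. g s / sum g S)"
    using assms pos by (intro sum_ennreal) (auto intro: less_imp_le)
  also have "\<dots> = 1" using pos by (simp add: sum_divide_distrib[symmetric])
  finally show ?thesis
    unfolding weights_pmf_def using assms pos by (intro pmf_embed_pmf) (auto intro: less_imp_le)
qed

lemma set_weights_pmf:
  assumes "finite S" "S \<noteq> {}" "\<And>s. s \<in> S \<Longrightarrow> 0 < g s"
  shows "set_pmf (weights_pmf S g) \<subseteq> S"
  using pmf_weights_pmf[OF assms] by (auto simp: set_pmf_eq split: if_splits)

lemma expectation_weights_pmf:
  fixes f :: "'s \<Rightarrow> real"
  assumes "finite S" "S \<noteq> {}" "\<And>s. s \<in> S \<Longrightarrow> 0 < g s"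
  shows "measure_pmf.expectation (weights_pmf S g) f = (\<Sum>s\<in>S. g s * f s) / sum g S"
proof -
  have sub: "set_pmf (weights_pmf S g) \<subseteq> S" by (rule set_weights_pmf[OF assms])
  have "measure_pmf.expectation (weights_pmf S g) f = (\<Sum>s\<in>S. pmf (weights_pmf S g) s *\<^sub>R f s)"
    using sub by (intro integral_measure_pmf[OF assms(1)]) auto
  also have "\<dots> = (\<Sum>s\<in>S. g s * f s / sum g S)"
    using pmf_weights_pmf[OF assms] by (intro sum.cong) auto
  finally show ?thesis by (simp add: sum_divide_distrib)
qed

lemma prob_weights_pmf:
  assumes "finite S" "S \<noteq> {}" "\<And>s. s \<in> S \<Longrightarrow> 0 < g s"
  shows "measure_pmf.prob (weights_pmf S g) A = sum g (S \<inter> A) / sum g S"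
proof -
  have "measure_pmf.prob (weights_pmf S g) A = measure_pmf.expectation (weights_pmf S g) (indicator A)"
    by simp
  also have "\<dots> = (\<Sum>s\<in>S. g s * indicator A s) / sum g S"
    by (rule expectation_weights_pmf[OF assms])
  finally show ?thesis using assms by (simp add: indicator_def sum.inter_restrict if_distrib cong: if_cong)
qed

text \<open>The factor \<open>exp c\<close> is paid twice, once for the numerator and once for the
  normaliser. This is why the weights of the mechanism may change only by
  \<open>exp (\<epsilon> / 2)\<close> between neighbours.\<close>

lemma prob_weights_pmf_le:
  fixes g g' :: "'s \<Rightarrow> real"
  assumes S: "finite S" "S \<noteq> {}" "\<And>s. s \<in> S \<Longrightarrow> 0 < g s" "\<And>s. s \<in> S \<Longrightarrow> 0 < g' s"
    and le: "\<And>s. s \<in> S \<Longrightarrow> g s \<le> exp c * g' s" "\<And>s. s \<in> S \<Longrightarrow> g' s \<le> exp c * g s"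
  shows "measure_pmf.prob (weights_pmf S g) A \<le> exp (2 * c) * measure_pmf.prob (weights_pmf S g') A"
proof -
  have pos: "0 < sum g S" "0 < sum g' S" using S by (auto intro!: sum_pos)
  have num: "sum g (S \<inter> A) \<le> exp c * sum g' (S \<inter> A)"
    unfolding sum_distrib_left using le by (intro sum_mono) auto
  have den: "sum g' S \<le> exp c * sum g S"
    unfolding sum_distrib_left using le by (intro sum_mono) auto
  have "sum g (S \<inter> A) * sum g' S \<le> (exp c * sum g' (S \<inter> A)) * (exp c * sum g S)"
    using pos S by (intro mult_mono num den mult_nonneg_nonneg sum_nonneg) (auto intro: less_imp_le)
  then have "sum g (S \<inter> A) / sum g S \<le> exp c * exp c * (sum g' (S \<inter> A) / sum g' S)"
    using pos by (simp add: field_simps)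
  also have "exp c * exp c = exp (2 * c)" by (simp add: exp_add[symmetric])
  finally show ?thesis using S by (simp add: prob_weights_pmf)
qed

section \<open>Hamming distance, histograms and query means\<close>

definition hamming :: "nat \<Rightarrow> (nat \<Rightarrow> 'a) \<Rightarrow> (nat \<Rightarrow> 'a) \<Rightarrow> nat" where
  "hamming n x x' = card {i \<in> {1..n}. x i \<noteq> x' i}"

lemma hamming_triangle: "hamming n x z \<le> hamming n x y + hamming n y z"
proof -
  have "{i \<in> {1..n}. x i \<noteq> z i} \<subseteq> {i \<in> {1..n}. x i \<noteq> y i} \<union> {i \<in> {1..n}. y i \<noteq> z i}" by auto
  then have "hamming n x z \<le> card ({i \<in> {1..n}. x i \<noteq> y i} \<union> {i \<in> {1..n}. y i \<noteq> z i})"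
    unfolding hamming_def by (intro card_mono) auto
  then show ?thesis unfolding hamming_def using card_Un_le order_trans by blast
qed

lemma hamming_commute: "hamming n x y = hamming n y x"
  unfolding hamming_def by (intro arg_cong[where f = card]) auto

lemma hamming_self: "hamming n x x = 0"
  by (simp add: hamming_def)

lemma hamming_le: "hamming n x y \<le> n"
proof -
  have "hamming n x y \<le> card {1..n}" unfolding hamming_def by (intro card_mono) auto
  then show ?thesis by simp
qed

definition histogram :: "nat \<Rightarrow> (nat \<Rightarrow> 'a) \<Rightarrow> 'a \<Rightarrow> real" where
  "histogram n x t = card {i \<in> {1..n}. x i = t} / n"

lemma sum_histogram:
  assumes "finite D" "x \<in> databases n D"
  shows "(\<Sum>t\<in>D. q t * histogram n x t) = query_mean n q x"
proof -
  have "(\<Sum>t\<in>D. q t * histogram n x t) = (\<Sum>t\<in>D. \<Sum>i | i \<in> {1..n} \<and> x i = t. q t / n)"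
    by (simp add: histogram_def mult.commute)
  also have "\<dots> = (\<Sum>t\<in>D. \<Sum>i | i \<in> {1..n} \<and> x i = t. q (x i) / n)"
    by (intro sum.cong) auto
  also have "\<dots> = (\<Sum>i\<in>{1..n}. q (x i) / n)"
    using assms by (intro sum.group) (auto simp: databases_def)
  finally show ?thesis by (simp add: query_mean_def sum_divide_distrib)
qed

text \<open>Only coordinates that differ contribute, each at most the oscillation \<open>c\<close>
  of \<open>q\<close>. The oscillation bound suits both bounded queries, with \<open>c = 2\<close>,
  and the unbounded cumulative gradients of the learner.\<close>

lemma query_mean_diff_le:
  assumes c: "\<And>s t. s \<in> D \<Longrightarrow> t \<in> D \<Longrightarrow> q s - q t \<le> c"
    and x: "x \<in> databases n D" "x' \<in> databases n D"
  shows "query_mean n q x' - query_mean n q x \<le> hamming n x x' / n * c"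
proof -
  have "(\<Sum>i = 1..n. q (x' i) - q (x i)) = (\<Sum>i | i \<in> {1..n} \<and> x i \<noteq> x' i. q (x' i) - q (x i))"
    by (intro sum.mono_neutral_right) auto
  also have "\<dots> \<le> hamming n x x' * c"
    unfolding hamming_def using x by (intro sum_bounded_above c) (auto simp: databases_def)
  finally have "1 / real n * (\<Sum>i = 1..n. q (x' i) - q (x i)) \<le> 1 / real n * (hamming n x x' * c)"
    by (intro mult_left_mono) auto
  then show ?thesis by (simp add: query_mean_def sum_subtractf right_diff_distrib)
qed

lemma finite_databases: "finite D \<Longrightarrow> finite (databases n D)"
  by (simp add: databases_def finite_PiE)

text \<open>Term \<open>j\<close> collects the databases at distance between 4 j / \<epsilon> and 4
  (j + 1) / \<epsilon>: the penalty gives - 2 j, the regret of the predictor gives (j + 1) / 2, and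
  the factor j + 1 is the distance in units of 4 / \<epsilon>.\<close>

lemma sum_geometric_block:
  fixes N :: nat
  shows "(\<Sum>j\<le>N. real (j + 1) * exp (- 2 * real j + real (j + 1) / 2)) \<le> 4"
proof -
  have e: "exp (1/2 :: real) \<le> 2" using exp_bound[of "1/2"] by (simp add: power2_eq_square)
  have "2 \<le> exp (3/4 :: real)"
    using exp_lower_Taylor_quadratic[of "3/4::real"] by (simp add: power2_eq_square)
  then have "2 * 2 \<le> exp (3/4 :: real) * exp (3/4)" by (intro mult_mono) auto
  then have e': "exp (- 3/2 :: real) \<le> 1/4" by (simp add: exp_minus field_simps exp_add[symmetric])
  \<comment> \<open>The decay rate 1/4 per block absorbs j + 1 \<le> 2^j and leaves a geometric
    series of ratio 1/2.\<close>
  have "(\<Sum>j\<le>N. real (j + 1) * exp (- 2 * real j + real (j + 1) / 2)) \<le> (\<Sum>j\<le>N. 2 * (1/2)^j)"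
  proof (intro sum_mono)
    fix j
    have "exp (- 2 * real j + real (j + 1) / 2) = exp (1/2) * exp (- 3/2) ^ j"
      by (simp add: exp_of_nat_mult[symmetric] exp_add[symmetric] field_simps)
    also have "\<dots> \<le> 2 * (1/4) ^ j" using e e' by (intro mult_mono power_mono) auto
    finally have exps: "exp (- 2 * real j + real (j + 1) / 2) \<le> 2 * (1/4) ^ j" .
    have "j + 1 \<le> 2 ^ j" unfolding Suc_eq_plus1[symmetric] by (rule Suc_leI[OF less_exp])
    then have "real (j + 1) \<le> 2 ^ j" by (metis of_nat_le_iff of_nat_numeral of_nat_power)
    with exps have "real (j + 1) * exp (- 2 * real j + real (j + 1) / 2) \<le> 2 ^ j * (2 * (1/4) ^ j)"
      by (intro mult_mono) auto
    also have "\<dots> = 2 * (2 * (1/4)) ^ j" unfolding power_mult_distrib by simp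
    finally show "real (j + 1) * exp (- 2 * real j + real (j + 1) / 2) \<le> 2 * (1/2)^j" by simp
  qed
  also have "\<dots> = 2 * (\<Sum>j<Suc N. (1/2)^j)" by (simp only: sum_distrib_left lessThan_Suc_atMost)
  also have "\<dots> \<le> 4" by (subst geometric_sum) (auto simp: field_simps)
  finally show ?thesis .
qed

section \<open>Multiplicative weights with exponentially sampled queries\<close>

text \<open>\<open>\<gamma>\<close> is the learning rate of the guess and \<open>\<eta>\<close> the
  inverse temperature of the query sampling. Errors are one-sided in the locale; the theorem takes
  for \<open>J\<close> the queries together with their negations.\<close>

locale query_game =
  fixes D :: "'a set" and J :: "('a \<Rightarrow> real) set" and \<gamma> \<eta> :: real
  assumes finite_D: "finite D" and D_ne: "D \<noteq> {}"
    and finite_J: "finite J" and J_ne: "J \<noteq> {}"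
    and bounded: "\<And>q t. q \<in> J \<Longrightarrow> t \<in> D \<Longrightarrow> \<bar>q t\<bar> \<le> 1"
    and \<gamma>_pos: "0 < \<gamma>" and \<gamma>_le: "\<gamma> \<le> 1" and \<eta>_pos: "0 < \<eta>"
begin

definition dot :: "('a \<Rightarrow> real) \<Rightarrow> ('a \<Rightarrow> real) \<Rightarrow> real" where
  "dot q h = (\<Sum>t\<in>D. q t * h t)"

lemma dot_diff: "dot q (\<lambda>t. h t - h' t) = dot q h - dot q h'"
  "dot (\<lambda>t. q t - q' t) h = dot q h - dot q' h"
  by (simp_all add: dot_def sum_subtractf algebra_simps)

lemma dot_uminus: "dot (\<lambda>t. - q t) h = - dot q h"
  by (simp add: dot_def sum_negf)

lemma dot_scale: "dot q (\<lambda>t. c * h t) = c * dot q h"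
  by (simp add: dot_def sum_distrib_left mult.left_commute)

lemma dot_add: "dot q (\<lambda>t. h t + h' t) = dot q h + dot q h'"
  by (simp add: dot_def sum.distrib algebra_simps)

lemma dot_average: "(\<Sum>r\<in>A. p r * dot (q r) h) = dot (\<lambda>t. \<Sum>r\<in>A. p r * q r t) h"
  unfolding dot_def by (subst sum_distrib_left, subst sum.swap) (simp add: sum_distrib_left sum_distrib_right mult.assoc)

text \<open>Sampling favours queries whose value on the histogram exceeds that on the guess, so
  sampled queries enter as gains and raise the weight of points where they are large.\<close>

definition hyp :: "('a \<Rightarrow> real) list \<Rightarrow> 'a \<Rightarrow> real" where
  "hyp qs = exp_weights D \<gamma> (\<lambda>t. \<Sum>q\<leftarrow>qs. q t)"

definition residual :: "('a \<Rightarrow> real) list \<Rightarrow> ('a \<Rightarrow> real) \<Rightarrow> ('a \<Rightarrow> real) \<Rightarrow> real" where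
  "residual qs h q = dot q (\<lambda>t. h t - hyp qs t)"

primrec likelihood :: "('a \<Rightarrow> real) \<Rightarrow> ('a \<Rightarrow> real) list \<Rightarrow> real" where
  "likelihood h [] = 1"
| "likelihood h (q # qs) = likelihood h qs * exp_weights J \<eta> (residual qs h) q"

text \<open>Each round contributes the guess held before its query is sampled: the initial uniform
  guess is counted, the guess after the last round is not.\<close>

primrec hyp_sum :: "('a \<Rightarrow> real) list \<Rightarrow> 'a \<Rightarrow> real" where
  "hyp_sum [] t = 0"
| "hyp_sum (q # qs) t = hyp_sum qs t + hyp qs t"

lemma likelihood_pos: "0 < likelihood h qs"
  by (induction qs) (auto intro!: mult_pos_pos exp_weights_pos finite_J J_ne)

lemma sum_likelihood: "(\<Sum>qs | set qs \<subseteq> J \<and> length qs = m. likelihood h qs) = 1"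
  by (rule sum_lists_sequential[where f = "\<lambda>qs. exp_weights J \<eta> (residual qs h)"])
    (simp_all add: sum_exp_weights finite_J J_ne)

section \<open>Likelihood of transcripts with inaccurate guesses\<close>

lemma exp_weights_le_margin:
  assumes "q' \<in> J"
  shows "exp_weights J \<eta> w q \<le> exp (\<eta> * (w q - w q'))"
proof -
  have "exp (\<eta> * w q') \<le> (\<Sum>r\<in>J. exp (\<eta> * w r))"
    using assms finite_J by (intro member_le_sum) auto
  then have "exp (\<eta> * w q) / (\<Sum>r\<in>J. exp (\<eta> * w r)) \<le> exp (\<eta> * w q) / exp (\<eta> * w q')"
    by (intro divide_left_mono mult_pos_pos sum_exp_pos finite_J J_ne) auto
  then show ?thesis by (simp add: exp_weights_def exp_diff right_diff_distrib)
qed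

text \<open>Multiplying the margins against the fixed query \<open>q\<close> leaves \<eta> times the
  summed residuals of the sampled queries minus those of \<open>q\<close>. The first sum is the
  regret of multiplicative weights against \<open>h\<close>, hence small.\<close>

lemma likelihood_le_margin:
  assumes h: "\<And>t. t \<in> D \<Longrightarrow> 0 \<le> h t" "(\<Sum>t\<in>D. h t) = 1" and qs: "set qs \<subseteq> J" and q: "q \<in> J"
  shows "likelihood h qs \<le> exp (\<eta> * (ln (card D) / \<gamma> + \<gamma> * length qs - (length qs * dot q h - dot q (hyp_sum qs))))"
proof -
  define G :: "('a \<Rightarrow> real) list \<Rightarrow> 'a \<Rightarrow> real" where "G = (\<lambda>qs t. \<Sum>q\<leftarrow>qs. q t)"
  have "likelihood h qs \<le> exp (\<eta> * (dot (G qs) h - hedge_gain D \<gamma> G qs - (length qs * dot q h - dot q (hyp_sum qs))))"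
    using qs
  proof (induction qs)
    case Nil
    then show ?case by (simp add: G_def dot_def)
  next
    case (Cons p qs)
    have step: "(\<Sum>s\<in>D. exp_weights D \<gamma> (G qs) s * (G (p # qs) s - G qs s)) = dot p (hyp qs)"
      by (simp add: G_def dot_def hyp_def mult.commute)
    have sum: "dot q (hyp_sum (p # qs)) = dot q (hyp_sum qs) + dot q (hyp qs)"
      by (simp add: dot_def sum.distrib algebra_simps)
    have G: "dot (G (p # qs)) h = dot p h + dot (G qs) h"
      by (simp add: G_def dot_def sum.distrib algebra_simps)
    have "likelihood h (p # qs) \<le> exp (\<eta> * (dot (G qs) h - hedge_gain D \<gamma> G qs - (length qs * dot q h - dot q (hyp_sum qs))))
        * exp (\<eta> * (residual qs h p - residual qs h q))"
      using Cons likelihood_pos[of h qs] exp_weights_pos[OF finite_J J_ne, of \<eta> "residual qs h" p]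
      by (auto intro!: mult_mono exp_weights_le_margin[OF q] intro: less_imp_le)
    also have "\<dots> = exp (\<eta> * (dot (G (p # qs)) h - hedge_gain D \<gamma> G (p # qs) - (length (p # qs) * dot q h - dot q (hyp_sum (p # qs)))))"
      unfolding hedge_gain.simps step sum G
      by (simp add: exp_add[symmetric] residual_def dot_diff algebra_simps)
    finally show ?case .
  qed
  \<comment> \<open>Regret against every point of \<open>D\<close> carries over to the convex
    combination \<open>h\<close>.\<close>
  moreover have "dot (G qs) h \<le> hedge_gain D \<gamma> G qs + (ln (card D) / \<gamma> + \<gamma> * length qs)"
  proof -
    have "G qs t \<le> hedge_gain D \<gamma> G qs + (ln (card D) / \<gamma> + \<gamma> * length qs)" if "t \<in> D" for t
      using hedge_regret[of D t \<gamma> 1 G J qs] that \<gamma>_pos \<gamma>_le finite_D bounded qs by (simp add: G_def)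
    then have "dot (G qs) h \<le> (\<Sum>t\<in>D. (hedge_gain D \<gamma> G qs + (ln (card D) / \<gamma> + \<gamma> * length qs)) * h t)"
      unfolding dot_def using h by (intro sum_mono mult_right_mono) auto
    then show ?thesis using h by (simp add: sum_distrib_left[symmetric])
  qed
  ultimately show ?thesis
    using \<eta>_pos by (elim order_trans) simp
qed

text \<open>An online learner for the logarithmic loss, confined to signed perturbations \<open>h + \<rho> (b - b')\<close>
  of \<open>h\<close> with \<open>b, b'\<close> in the simplex.
  Its cumulative gradients are recorded in \<open>gradient\<close>.\<close>

definition perturb :: "real \<Rightarrow> real \<Rightarrow> ('a \<Rightarrow> real) \<Rightarrow> ('a \<Rightarrow> real) \<Rightarrow> 'a \<Rightarrow> real" where
  "perturb \<rho> \<beta> h L t = h t + \<rho> * (exp_weights D \<beta> L t - exp_weights D \<beta> (\<lambda>s. - L s) t)"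

primrec gradient :: "real \<Rightarrow> real \<Rightarrow> ('a \<Rightarrow> real) \<Rightarrow> ('a \<Rightarrow> real) list \<Rightarrow> 'a \<Rightarrow> real" where
  "gradient \<rho> \<beta> h [] = (\<lambda>t. 0)"
| "gradient \<rho> \<beta> h (q # qs) = (\<lambda>t. gradient \<rho> \<beta> h qs t + (q t -
     (\<Sum>r\<in>J. exp_weights J \<eta> (residual qs (perturb \<rho> \<beta> h (gradient \<rho> \<beta> h qs))) r * r t)))"

text \<open>For fixed \<open>h\<close>, \<open>\<rho>\<close> and \<open>\<beta>\<close> this is a
  single probability distribution on transcripts of a given length. It has to compete with the
  likelihoods of all histograms near \<open>h\<close> at once.\<close>

primrec predictor :: "real \<Rightarrow> real \<Rightarrow> ('a \<Rightarrow> real) \<Rightarrow> ('a \<Rightarrow> real) list \<Rightarrow> real" where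
  "predictor \<rho> \<beta> h [] = 1"
| "predictor \<rho> \<beta> h (q # qs) = predictor \<rho> \<beta> h qs *
     exp_weights J \<eta> (residual qs (perturb \<rho> \<beta> h (gradient \<rho> \<beta> h qs))) q"

lemma predictor_pos: "0 < predictor \<rho> \<beta> h qs"
  by (induction qs) (auto intro!: mult_pos_pos exp_weights_pos finite_J J_ne)

lemma sum_predictor: "(\<Sum>qs | set qs \<subseteq> J \<and> length qs = m. predictor \<rho> \<beta> h qs) = 1"
  by (rule sum_lists_sequential[where f =
      "\<lambda>qs. exp_weights J \<eta> (residual qs (perturb \<rho> \<beta> h (gradient \<rho> \<beta> h qs)))"])
    (simp_all add: sum_exp_weights finite_J J_ne)

text \<open>Concavity of the log-likelihood reduces the comparison to linear regret. The assumption
  on \<open>h'\<close> says, through support functions, that \<open>h' - h\<close> is \<rho> times a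
  difference of two probability vectors; one copy of multiplicative weights, on \<open>G\<close>,
  handles the first vector and another, on \<open>N = - G\<close>, the second.\<close>

lemma likelihood_le_predictor:
  fixes \<rho> \<beta> :: real
  assumes \<beta>: "0 < \<beta>" "\<beta> * 2 \<le> 1" and \<rho>: "0 \<le> \<rho>" and qs: "set qs \<subseteq> J"
    and h': "\<And>L c. (\<And>s t. s \<in> D \<Longrightarrow> t \<in> D \<Longrightarrow> L s - L t \<le> c) \<Longrightarrow> dot L (\<lambda>t. h' t - h t) \<le> \<rho> * c"
  shows "likelihood h' qs \<le> predictor \<rho> \<beta> h qs * exp (\<eta> * (\<rho> * (2 * (ln (card D) / \<beta> + \<beta> * 4 * length qs))))"
proof -
  define G where "G = gradient \<rho> \<beta> h"
  define N where "N = (\<lambda>qs t. - G qs t)"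
  have "likelihood h' qs \<le> predictor \<rho> \<beta> h qs *
      exp (\<eta> * (dot (G qs) (\<lambda>t. h' t - h t) - \<rho> * (hedge_gain D \<beta> G qs + hedge_gain D \<beta> N qs)))"
    using qs
  proof (induction qs)
    case Nil
    then show ?case by (simp add: G_def dot_def)
  next
    case (Cons q qs)
    define w where "w = residual qs (perturb \<rho> \<beta> h (G qs))"
    define v where "v = (\<lambda>t. q t - (\<Sum>r\<in>J. exp_weights J \<eta> w r * r t))"
    have G: "G (q # qs) = (\<lambda>t. G qs t + v t)" by (simp add: G_def v_def w_def)
    have diff: "residual qs h' r - w r = dot r (\<lambda>t. h' t - perturb \<rho> \<beta> h (G qs) t)" for r
      by (simp add: w_def residual_def dot_diff)
    \<comment> \<open>\<open>\<eta> * v\<close> is the gradient of the round's log-likelihood at the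
      learner's point, so concavity bounds the advantage of \<open>h'\<close> by the linear
      term.\<close>
    have "exp_weights J \<eta> (residual qs h') q \<le> exp_weights J \<eta> w q *
        exp (\<eta> * dot v (\<lambda>t. h' t - perturb \<rho> \<beta> h (G qs) t))"
      using exp_weights_le[OF finite_J J_ne, of \<eta> "residual qs h'" q w]
      by (simp add: diff dot_average v_def dot_diff(2))
    also have "dot v (\<lambda>t. h' t - perturb \<rho> \<beta> h (G qs) t) = dot v (\<lambda>t. h' t - h t)
        - \<rho> * (dot v (exp_weights D \<beta> (G qs)) - dot v (exp_weights D \<beta> (N qs)))"
      by (simp add: perturb_def N_def dot_diff dot_add dot_scale)
    finally have step: "exp_weights J \<eta> (residual qs h') q \<le> exp_weights J \<eta> w q *
        exp (\<eta> * (dot v (\<lambda>t. h' t - h t) - \<rho> * (dot v (exp_weights D \<beta> (G qs)) - dot v (exp_weights D \<beta> (N qs)))))" .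
    have gains: "hedge_gain D \<beta> G (q # qs) = hedge_gain D \<beta> G qs + dot v (exp_weights D \<beta> (G qs))"
      "hedge_gain D \<beta> N (q # qs) = hedge_gain D \<beta> N qs - dot v (exp_weights D \<beta> (N qs))"
      by (simp_all add: N_def G dot_def mult.commute sum_negf)
    have dotG: "dot (G (q # qs)) (\<lambda>t. h' t - h t) = dot (G qs) (\<lambda>t. h' t - h t) + dot v (\<lambda>t. h' t - h t)"
      by (simp add: G dot_def sum.distrib[symmetric] algebra_simps)
    have "likelihood h' (q # qs) \<le> (predictor \<rho> \<beta> h qs *
        exp (\<eta> * (dot (G qs) (\<lambda>t. h' t - h t) - \<rho> * (hedge_gain D \<beta> G qs + hedge_gain D \<beta> N qs)))) *
        (exp_weights J \<eta> w q *
        exp (\<eta> * (dot v (\<lambda>t. h' t - h t) - \<rho> * (dot v (exp_weights D \<beta> (G qs)) - dot v (exp_weights D \<beta> (N qs))))))"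
      unfolding likelihood.simps using Cons
      by (intro mult_mono step) (auto intro!: mult_nonneg_nonneg less_imp_le[OF predictor_pos]
          less_imp_le[OF likelihood_pos] less_imp_le[OF exp_weights_pos] finite_J J_ne)
    also have "\<dots> = predictor \<rho> \<beta> h (q # qs) * exp (\<eta> * (dot (G (q # qs)) (\<lambda>t. h' t - h t)
        - \<rho> * (hedge_gain D \<beta> G (q # qs) + hedge_gain D \<beta> N (q # qs))))"
      unfolding gains dotG by (simp add: w_def G_def exp_add[symmetric] algebra_simps)
    finally show ?case .
  qed
  also have "\<dots> \<le> predictor \<rho> \<beta> h qs * exp (\<eta> * (\<rho> * (2 * (ln (card D) / \<beta> + \<beta> * 4 * length qs))))"
  proof -
    let ?R = "ln (card D) / \<beta> + \<beta> * 4 * length qs"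
    \<comment> \<open>An increment is a query value minus an average of query values, all in
      [-1, 1]; hence the factor 4 = 2^2 in the regret.\<close>
    have step: "\<bar>G (q # qs) t - G qs t\<bar> \<le> 2" if "t \<in> D" "q \<in> J" for q qs t
    proof -
      have "\<bar>\<Sum>r\<in>J. exp_weights J \<eta> (residual qs (perturb \<rho> \<beta> h (gradient \<rho> \<beta> h qs))) r * r t\<bar> \<le> 1"
        using that by (intro abs_average_le sum_exp_weights less_imp_le[OF exp_weights_pos] finite_J J_ne bounded)
      with bounded[OF that(2,1)] show ?thesis by (simp add: G_def)
    qed
    \<comment> \<open>The regrets of the two copies, against the points \<open>s\<close> and
      \<open>t\<close>, bound the oscillation of \<open>G qs\<close>, as the assumption on
      \<open>h'\<close> requires.\<close>
    have "G qs s - G qs t \<le> hedge_gain D \<beta> G qs + hedge_gain D \<beta> N qs + 2 * ?R" if "s \<in> D" "t \<in> D" for s t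
    proof -
      have "G qs s \<le> hedge_gain D \<beta> G qs + ?R"
        using hedge_regret[of D s \<beta> 2 G J qs] that(1) \<beta> finite_D step qs by (simp add: G_def)
      moreover have "N qs t \<le> hedge_gain D \<beta> N qs + ?R"
        using hedge_regret[of D t \<beta> 2 N J qs] that(2) \<beta> finite_D step qs
        by (simp add: N_def G_def abs_minus_commute)
      ultimately show ?thesis by (simp add: N_def)
    qed
    then have "dot (G qs) (\<lambda>t. h' t - h t) \<le> \<rho> * (hedge_gain D \<beta> G qs + hedge_gain D \<beta> N qs + 2 * ?R)"
      by (rule h')
    then have "dot (G qs) (\<lambda>t. h' t - h t) - \<rho> * (hedge_gain D \<beta> G qs + hedge_gain D \<beta> N qs) \<le> \<rho> * (2 * ?R)"
      by (simp add: algebra_simps)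
    then show ?thesis
      using \<eta>_pos predictor_pos by (intro mult_left_mono) (auto intro: less_imp_le)
  qed
  finally show ?thesis .
qed

section \<open>The mechanism\<close>

text \<open>On the logarithmic scale, for \<epsilon> \<ge> 0, this is the least function of
  \<open>x\<close> above the log-likelihood that is Lipschitz with constant \<epsilon> / 2 in
  Hamming distance.\<close>

definition weight :: "nat \<Rightarrow> real \<Rightarrow> (nat \<Rightarrow> 'a) \<Rightarrow> ('a \<Rightarrow> real) list \<Rightarrow> real" where
  "weight n \<epsilon> x y = Max ((\<lambda>x'. exp (- (\<epsilon> / 2 * hamming n x x')) * likelihood (histogram n x') y) ` databases n D)"

lemma le_weight:
  assumes "x' \<in> databases n D"
  shows "exp (- (\<epsilon> / 2 * hamming n x x')) * likelihood (histogram n x') y \<le> weight n \<epsilon> x y"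
  unfolding weight_def using assms by (intro Max_ge) (auto simp: finite_databases finite_D)

lemma likelihood_le_weight:
  assumes "x \<in> databases n D"
  shows "likelihood (histogram n x) y \<le> weight n \<epsilon> x y"
  using le_weight[OF assms, of \<epsilon> x y] by (simp add: hamming_self)

lemma weight_pos:
  assumes "x \<in> databases n D"
  shows "0 < weight n \<epsilon> x y"
  using likelihood_le_weight[OF assms] likelihood_pos less_le_trans by blast

lemma weight_attained:
  assumes "x \<in> databases n D"
  obtains x' where "x' \<in> databases n D"
    "weight n \<epsilon> x y = exp (- (\<epsilon> / 2 * hamming n x x')) * likelihood (histogram n x') y"
proof -
  have "weight n \<epsilon> x y \<in> (\<lambda>x'. exp (- (\<epsilon> / 2 * hamming n x x')) * likelihood (histogram n x') y) ` databases n D"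
    unfolding weight_def using assms by (intro Max_in) (auto simp: finite_databases finite_D)
  then show ?thesis using that by auto
qed

text \<open>The maximiser for \<open>x\<close> is a candidate for \<open>z\<close>, and the triangle
  inequality bounds its extra penalty.\<close>

lemma weight_lipschitz:
  fixes \<epsilon> :: real
  assumes "x \<in> databases n D" "z \<in> databases n D" "0 \<le> \<epsilon>"
  shows "weight n \<epsilon> x y \<le> exp (\<epsilon> / 2 * hamming n x z) * weight n \<epsilon> z y"
proof -
  obtain x' where x': "x' \<in> databases n D"
    "weight n \<epsilon> x y = exp (- (\<epsilon> / 2 * hamming n x x')) * likelihood (histogram n x') y"
    using weight_attained[OF assms(1)] .
  have "real (hamming n z x') \<le> hamming n x z + hamming n x x'"
    using hamming_triangle[of n z x' x] by (simp add: hamming_commute)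
  then have "\<epsilon> / 2 * hamming n z x' \<le> \<epsilon> / 2 * (real (hamming n x z) + hamming n x x')"
    using assms by (intro mult_left_mono) auto
  then have "exp (- (\<epsilon> / 2 * hamming n x x')) \<le> exp (\<epsilon> / 2 * hamming n x z) * exp (- (\<epsilon> / 2 * hamming n z x'))"
    by (simp add: exp_add[symmetric] algebra_simps)
  then have "weight n \<epsilon> x y \<le> (exp (\<epsilon> / 2 * hamming n x z) * exp (- (\<epsilon> / 2 * hamming n z x'))) * likelihood (histogram n x') y"
    unfolding x'(2) using likelihood_pos by (intro mult_right_mono) (auto intro: less_imp_le)
  also have "\<dots> \<le> exp (\<epsilon> / 2 * hamming n x z) * weight n \<epsilon> z y"
    using le_weight[OF x'(1), of \<epsilon> z y] by (simp add: mult.assoc)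
  finally show ?thesis .
qed

lemma dot_histogram: "x \<in> databases n D \<Longrightarrow> dot q (histogram n x) = query_mean n q x"
  unfolding dot_def by (rule sum_histogram[OF finite_D])

text \<open>Changing at most \<rho> n records moves a linear functional of the histogram by at most
  \<rho> times its oscillation, which is the condition of
  \<open>likelihood_le_predictor\<close>.\<close>

lemma likelihood_histogram_le:
  fixes \<rho> \<beta> :: real
  assumes n: "n \<ge> 1" and x: "x \<in> databases n D" "x' \<in> databases n D"
    and \<rho>: "hamming n x x' \<le> \<rho> * n"
    and \<beta>: "0 < \<beta>" "\<beta> * 2 \<le> 1" and y: "set y \<subseteq> J"
  shows "likelihood (histogram n x') y \<le> predictor \<rho> \<beta> (histogram n x) y *
    exp (\<eta> * (\<rho> * (2 * (ln (card D) / \<beta> + \<beta> * 4 * length y))))"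
proof (rule likelihood_le_predictor[OF \<beta> _ y])
  have "0 \<le> \<rho> * real n" using \<rho> order_trans of_nat_0_le_iff by blast
  then show "0 \<le> \<rho>" using n by (simp add: zero_le_mult_iff)
  fix L :: "'a \<Rightarrow> real" and c :: real
  assume L: "\<And>s t. s \<in> D \<Longrightarrow> t \<in> D \<Longrightarrow> L s - L t \<le> c"
  \<comment> \<open>Taking both points equal shows \<open>0 \<le> c\<close>, so the distance over
    \<open>n\<close> can be enlarged to \<rho>.\<close>
  obtain t where "t \<in> D" using D_ne by auto
  from L[OF this this] have "0 \<le> c" by simp
  have "dot L (\<lambda>t. histogram n x' t - histogram n x t) = query_mean n L x' - query_mean n L x"
    using x by (simp add: dot_diff dot_histogram)
  also have "\<dots> \<le> hamming n x x' / n * c" by (rule query_mean_diff_le[OF L x])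
  also have "\<dots> \<le> \<rho> * c" using n \<rho> \<open>0 \<le> c\<close> by (intro mult_right_mono) (simp add: field_simps)
  finally show "dot L (\<lambda>t. histogram n x' t - histogram n x t) \<le> \<rho> * c" .
qed

text \<open>A signed maximum: once \<open>J\<close> is closed under negation it bounds the sup norm
  of the error of the average guess.\<close>

definition error :: "nat \<Rightarrow> (nat \<Rightarrow> 'a) \<Rightarrow> ('a \<Rightarrow> real) list \<Rightarrow> real" where
  "error n x y = Max ((\<lambda>q. query_mean n q x - dot q (hyp_sum y) / length y) ` J)"

lemma error_ge: "q \<in> J \<Longrightarrow> query_mean n q x - dot q (hyp_sum y) / length y \<le> error n x y"
  unfolding error_def using finite_J by (intro Max_ge) auto

lemma error_attained:
  obtains q where "q \<in> J" "error n x y = query_mean n q x - dot q (hyp_sum y) / length y"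
proof -
  have "error n x y \<in> (\<lambda>q. query_mean n q x - dot q (hyp_sum y) / length y) ` J"
    unfolding error_def using finite_J J_ne by (intro Max_in) auto
  then show ?thesis using that by auto
qed

lemma dot_hyp_sum: "q \<in> J \<Longrightarrow> \<bar>dot q (hyp_sum y)\<bar> \<le> length y"
proof (induction y)
  case (Cons p y)
  have "\<bar>\<Sum>t\<in>D. hyp y t * q t\<bar> \<le> 1"
    unfolding hyp_def using Cons.prems
    by (intro abs_average_le sum_exp_weights less_imp_le[OF exp_weights_pos] finite_D D_ne bounded)
  moreover have "dot q (hyp_sum (p # y)) = dot q (hyp_sum y) + (\<Sum>t\<in>D. hyp y t * q t)"
    by (simp add: dot_def sum.distrib algebra_simps)
  ultimately show ?case using Cons.IH[OF Cons.prems] unfolding list.size(4) of_nat_add of_nat_1 by linarith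
qed (simp add: dot_def)

lemma abs_query_mean_le:
  assumes "q \<in> J" "x \<in> databases n D"
  shows "\<bar>query_mean n q x\<bar> \<le> 1"
proof -
  have "\<bar>\<Sum>i = 1..n. q (x i)\<bar> \<le> (\<Sum>i = 1..n. 1)"
    using assms by (intro order_trans[OF sum_abs] sum_mono bounded) (auto simp: databases_def)
  then show ?thesis by (simp add: query_mean_def divide_le_eq)
qed

lemma error_le:
  assumes "x \<in> databases n D"
  shows "error n x y \<le> 2"
proof -
  obtain q where q: "q \<in> J" "error n x y = query_mean n q x - dot q (hyp_sum y) / length y"
    using error_attained .
  have "\<bar>dot q (hyp_sum y) / length y\<bar> \<le> 1"
    using dot_hyp_sum[OF q(1), of y] by (simp add: divide_le_eq)
  then show ?thesis using q abs_query_mean_le[OF q(1) assms] by linarith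
qed

lemma error_lipschitz:
  assumes "x \<in> databases n D" "x' \<in> databases n D"
  shows "error n x y \<le> error n x' y + 2 * hamming n x x' / n"
proof -
  obtain q where q: "q \<in> J" "error n x y = query_mean n q x - dot q (hyp_sum y) / length y"
    using error_attained .
  have "query_mean n q x - query_mean n q x' \<le> hamming n x' x / n * 2"
  proof (rule query_mean_diff_le[OF _ assms(2,1)])
    fix s t assume "s \<in> D" "t \<in> D"
    then show "q s - q t \<le> 2" using bounded[OF q(1), of s] bounded[OF q(1), of t] by linarith
  qed
  then show ?thesis using q(2) error_ge[OF q(1), of n x' y] by (simp add: hamming_commute mult.commute)
qed

section \<open>Expected error of a sampled transcript\<close>

lemma likelihood_le_error:
  assumes n: "n \<ge> 1" and x: "x \<in> databases n D" and y: "set y \<subseteq> J" "length y = m" and m: "m \<ge> 1"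
  shows "likelihood (histogram n x) y \<le> exp (\<eta> * (ln (card D) / \<gamma> + \<gamma> * m - m * error n x y))"
proof -
  obtain q where q: "q \<in> J" "error n x y = query_mean n q x - dot q (hyp_sum y) / length y"
    using error_attained .
  have "(\<Sum>t\<in>D. histogram n x t) = 1"
    using sum_histogram[OF finite_D x, of "\<lambda>t. 1"] n by (simp add: query_mean_def)
  then show ?thesis
    using likelihood_le_margin[of "histogram n x", OF _ _ y(1) q(1)] y(2) m x
    by (simp add: q(2) histogram_def dot_histogram right_diff_distrib)
qed

text \<open>The distances from \<open>x\<close> are grouped into blocks of width \<open>4 / \<epsilon>\<close>.\<close>

lemma weight_times_distance_le:
  fixes \<epsilon> \<beta> :: real
  assumes n: "n \<ge> 1" and \<epsilon>: "0 < \<epsilon>" and x: "x \<in> databases n D" "x' \<in> databases n D"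
    and \<beta>: "0 < \<beta>" "\<beta> * 2 \<le> 1" and y: "set y \<subseteq> J" "length y = m"
    and stable: "\<eta> * (2 * (ln (card D) / \<beta> + \<beta> * 4 * m)) \<le> \<epsilon> * n / 8"
    and N: "N = nat \<lfloor>\<epsilon> * n / 4\<rfloor>"
  shows "exp (- (\<epsilon> / 2 * hamming n x x')) * likelihood (histogram n x') y * hamming n x x'
    \<le> (\<Sum>j\<le>N. (4 / \<epsilon> * (real (j + 1) * exp (- 2 * real j + real (j + 1) / 2)))
        * predictor (4 * real (j + 1) / (\<epsilon> * n)) \<beta> (histogram n x) y)"
proof -
  define d where "d = hamming n x x'"
  define j where "j = nat \<lfloor>\<epsilon> * d / 4\<rfloor>"
  \<comment> \<open>\<open>\<rho> * n\<close> is the outer radius of block \<open>j\<close>, which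
    contains the distance \<open>d\<close>.\<close>
  define \<rho> where "\<rho> = 4 * real (j + 1) / (\<epsilon> * n)"
  have "0 \<le> \<epsilon> * d / 4" using \<epsilon> by simp
  then have j: "real j \<le> \<epsilon> * d / 4" "\<epsilon> * d / 4 < real j + 1"
    unfolding j_def by linarith+
  have "d \<le> n" by (simp add: d_def hamming_le)
  then have "\<epsilon> * d / 4 \<le> \<epsilon> * n / 4" using \<epsilon> by (simp add: mult_left_mono)
  then have "j \<le> N" unfolding j_def N by (intro nat_mono floor_mono)
  have d: "d \<le> 4 / \<epsilon> * real (j + 1)" using j \<epsilon> by (simp add: field_simps)
  have "4 / \<epsilon> * real (j + 1) = \<rho> * n" using n by (simp add: \<rho>_def)
  with d have "likelihood (histogram n x') y \<le> predictor \<rho> \<beta> (histogram n x) y *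
      exp (\<eta> * (\<rho> * (2 * (ln (card D) / \<beta> + \<beta> * 4 * m))))"
    using likelihood_histogram_le[OF n x _ \<beta> y(1), of \<rho>] y(2) by (simp add: d_def)
  also have "\<dots> \<le> predictor \<rho> \<beta> (histogram n x) y * exp (real (j + 1) / 2)"
  proof -
    have "0 \<le> \<rho>" using \<epsilon> by (simp add: \<rho>_def)
    then have "\<rho> * (\<eta> * (2 * (ln (card D) / \<beta> + \<beta> * 4 * m))) \<le> \<rho> * (\<epsilon> * n / 8)"
      by (intro mult_left_mono stable)
    also have "\<dots> = real (j + 1) / 2" using \<epsilon> n by (simp add: \<rho>_def field_simps)
    finally show ?thesis using predictor_pos
      by (intro mult_left_mono) (auto simp: algebra_simps intro: less_imp_le)
  qed
  finally have lik: "likelihood (histogram n x') y \<le> predictor \<rho> \<beta> (histogram n x) y * exp (real (j + 1) / 2)" .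
  have "exp (- (\<epsilon> / 2 * d)) * likelihood (histogram n x') y * d
      \<le> exp (- 2 * real j) * (predictor \<rho> \<beta> (histogram n x) y * exp (real (j + 1) / 2)) * (4 / \<epsilon> * real (j + 1))"
    using j(1) d lik \<epsilon> less_imp_le[OF likelihood_pos] less_imp_le[OF predictor_pos]
    by (intro mult_mono) auto
  also have "\<dots> = (4 / \<epsilon> * (real (j + 1) * exp (- 2 * real j + real (j + 1) / 2))) * predictor \<rho> \<beta> (histogram n x) y"
    by (simp only: exp_add mult_ac)
  \<comment> \<open>Summing over all blocks removes the dependence on \<open>x'\<close>, which will
    be a maximiser that varies with the transcript.\<close>
  also have "\<dots> \<le> (\<Sum>j\<le>N. (4 / \<epsilon> * (real (j + 1) * exp (- 2 * real j + real (j + 1) / 2)))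
        * predictor (4 * real (j + 1) / (\<epsilon> * n)) \<beta> (histogram n x) y)"
    unfolding \<rho>_def using \<open>j \<le> N\<close> \<epsilon> less_imp_le[OF predictor_pos]
    by (intro member_le_sum[where f = "\<lambda>j. (4 / \<epsilon> * (real (j + 1) * exp (- 2 * real j + real (j + 1) / 2)))
        * predictor (4 * real (j + 1) / (\<epsilon> * n)) \<beta> (histogram n x) y"]) auto
  finally show ?thesis unfolding d_def .
qed

text \<open>Let \<open>x'\<close> attain the weight of \<open>y\<close>. If \<open>y\<close> is
  accurate for \<open>x'\<close>, its error for \<open>x\<close> exceeds \<alpha> by at most twice
  the distance over \<open>n\<close>, and the penalised distance is controlled by the predictors.
  Otherwise its likelihood is tiny, so a union over all \<open>card J ^ m\<close> transcripts is
  affordable.\<close>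

lemma sum_weight_error_le:
  fixes \<epsilon> \<alpha> \<beta> :: real
  assumes n: "n \<ge> 1" and m: "m \<ge> 1" and \<epsilon>: "0 < \<epsilon>" and x: "x \<in> databases n D"
    and \<beta>: "0 < \<beta>" "\<beta> * 2 \<le> 1" and \<alpha>: "0 \<le> \<alpha>"
    and stable: "\<eta> * (2 * (ln (card D) / \<beta> + \<beta> * 4 * m)) \<le> \<epsilon> * n / 8"
  defines "Y \<equiv> {y. set y \<subseteq> J \<and> length y = m}"
  shows "(\<Sum>y\<in>Y. weight n \<epsilon> x y * error n x y) \<le> \<alpha> * (\<Sum>y\<in>Y. weight n \<epsilon> x y) + 32 / (\<epsilon> * n)
    + 2 * (real (card J) ^ m * exp (\<eta> * (ln (card D) / \<gamma> + \<gamma> * m - m * \<alpha>)))"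
proof -
  let ?X = "exp (\<eta> * (ln (card D) / \<gamma> + \<gamma> * m - m * \<alpha>))"
  define N where "N = nat \<lfloor>\<epsilon> * n / 4\<rfloor>"
  define a where "a j = 4 / \<epsilon> * (real (j + 1) * exp (- 2 * real j + real (j + 1) / 2))" for j :: nat
  define P where "P j = predictor (4 * real (j + 1) / (\<epsilon> * n)) \<beta> (histogram n x)" for j :: nat
  have P: "0 \<le> P j y" "0 \<le> a j" for j y
    using predictor_pos \<epsilon> by (auto simp: P_def a_def intro: less_imp_le)
  have pointwise: "weight n \<epsilon> x y * error n x y \<le> \<alpha> * weight n \<epsilon> x y + 2 / n * (\<Sum>j\<le>N. a j * P j y) + 2 * ?X"
    if y: "y \<in> Y" for y
  proof -
    have y': "set y \<subseteq> J" "length y = m" using y by (auto simp: Y_def)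
    obtain x' where x': "x' \<in> databases n D"
      "weight n \<epsilon> x y = exp (- (\<epsilon> / 2 * hamming n x x')) * likelihood (histogram n x') y"
      using weight_attained[OF x] .
    have w: "0 < weight n \<epsilon> x y" by (rule weight_pos[OF x])
    have nn: "0 \<le> (\<Sum>j\<le>N. a j * P j y)" using P by (intro sum_nonneg) auto
    show ?thesis
    proof (cases "error n x' y \<le> \<alpha>")
      case True
      have "weight n \<epsilon> x y * error n x y \<le> weight n \<epsilon> x y * (\<alpha> + 2 * hamming n x x' / n)"
        using error_lipschitz[OF x x'(1), of y] True w by (intro mult_left_mono) auto
      also have "\<dots> = \<alpha> * weight n \<epsilon> x y + 2 / n * (weight n \<epsilon> x y * hamming n x x')"
        by (simp add: algebra_simps)
      also have "\<dots> \<le> \<alpha> * weight n \<epsilon> x y + 2 / n * (\<Sum>j\<le>N. a j * P j y)"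
        using weight_times_distance_le[OF n \<epsilon> x x'(1) \<beta> y' stable N_def]
        by (intro add_left_mono mult_left_mono) (auto simp: x'(2) a_def P_def)
      finally show ?thesis by (simp add: add_increasing2)
    next
      case False
      have "weight n \<epsilon> x y \<le> 1 * likelihood (histogram n x') y"
        unfolding x'(2) using \<epsilon> likelihood_pos by (intro mult_right_mono) (auto intro: less_imp_le)
      also have "\<dots> \<le> exp (\<eta> * (ln (card D) / \<gamma> + \<gamma> * m - m * error n x' y))"
        using likelihood_le_error[OF n x'(1) y' m] by simp
      also have "\<dots> \<le> ?X"
        using False \<eta>_pos by (simp add: mult_left_mono)
      finally have "weight n \<epsilon> x y * error n x y \<le> weight n \<epsilon> x y * 2" "weight n \<epsilon> x y \<le> ?X"
        using error_le[OF x, of y] w by (auto intro: mult_left_mono)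
      then have "weight n \<epsilon> x y * error n x y \<le> 2 * ?X" by linarith
      moreover have "0 \<le> \<alpha> * weight n \<epsilon> x y" "0 \<le> 2 / n * (\<Sum>j\<le>N. a j * P j y)"
        using \<alpha> w nn by auto
      ultimately show ?thesis by linarith
    qed
  qed
  have swap: "(\<Sum>y\<in>Y. \<Sum>j\<le>N. a j * P j y) = (\<Sum>j\<le>N. a j * (\<Sum>y\<in>Y. P j y))"
    by (subst sum.swap) (simp add: sum_distrib_left)
  have "(\<Sum>y\<in>Y. weight n \<epsilon> x y * error n x y) \<le> (\<Sum>y\<in>Y. \<alpha> * weight n \<epsilon> x y + 2 / n * (\<Sum>j\<le>N. a j * P j y) + 2 * ?X)"
    by (intro sum_mono pointwise)
  also have "\<dots> = \<alpha> * (\<Sum>y\<in>Y. weight n \<epsilon> x y) + 2 / n * (\<Sum>j\<le>N. a j * (\<Sum>y\<in>Y. P j y)) + 2 * (card Y * ?X)"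
    by (simp add: sum.distrib sum_distrib_left[symmetric] sum_divide_distrib[symmetric] swap)
  also have "(\<Sum>j\<le>N. a j * (\<Sum>y\<in>Y. P j y)) = (\<Sum>j\<le>N. a j)"
    by (simp add: P_def Y_def sum_predictor)
  also have "card Y = card J ^ m" unfolding Y_def by (rule card_lists_length_eq[OF finite_J])
  \<comment> \<open>The predictors have been summed out; the block series is at most 4, giving 32 /
    (\<epsilon> n).\<close>
  also have "2 / n * (\<Sum>j\<le>N. a j) \<le> 2 / n * (4 / \<epsilon> * 4)"
    unfolding a_def sum_distrib_left[symmetric] using \<epsilon> by (intro mult_left_mono sum_geometric_block) auto
  finally show ?thesis by (simp add: mult.commute)
qed

text \<open>Weights dominate a probability distribution. Dividing by the normaliser therefore does
  not increase the additive error terms.\<close>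

lemma sum_weight_ge_1:
  assumes "x \<in> databases n D"
  shows "1 \<le> (\<Sum>y | set y \<subseteq> J \<and> length y = m. weight n \<epsilon> x y)"
  unfolding sum_likelihood[of "histogram n x" m, symmetric]
  by (intro sum_mono likelihood_le_weight assms)

lemma expectation_error_le:
  fixes \<epsilon> \<alpha> \<beta> \<delta> :: real
  assumes n: "n \<ge> 1" and m: "m \<ge> 1" and \<epsilon>: "0 < \<epsilon>" and x: "x \<in> databases n D"
    and \<beta>: "0 < \<beta>" "\<beta> * 2 \<le> 1" and \<alpha>: "0 \<le> \<alpha>"
    and stable: "\<eta> * (2 * (ln (card D) / \<beta> + \<beta> * 4 * m)) \<le> \<epsilon> * n / 8"
    and \<delta>: "real (card J) ^ m * exp (\<eta> * (ln (card D) / \<gamma> + \<gamma> * m - m * \<alpha>)) \<le> \<delta>"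
    and f: "\<And>y. set y \<subseteq> J \<Longrightarrow> length y = m \<Longrightarrow> f y \<le> error n x y"
  defines "Y \<equiv> {y. set y \<subseteq> J \<and> length y = m}"
  shows "measure_pmf.expectation (weights_pmf Y (weight n \<epsilon> x)) f \<le> \<alpha> + (32 / (\<epsilon> * n) + 2 * \<delta>)"
proof -
  let ?Z = "\<Sum>y\<in>Y. weight n \<epsilon> x y"
  have Z: "1 \<le> ?Z" unfolding Y_def by (rule sum_weight_ge_1[OF x])
  have Y: "finite Y" unfolding Y_def by (rule finite_lists_length_eq[OF finite_J])
  have Y_ne: "Y \<noteq> {}" using Z by force
  have pos: "0 < weight n \<epsilon> x y" for y by (rule weight_pos[OF x])
  have "0 \<le> \<delta>" by (rule order_trans[OF _ \<delta>]) simp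
  then have nonneg: "0 \<le> 32 / (\<epsilon> * n) + 2 * \<delta>" using \<epsilon> by simp
  have "(\<Sum>y\<in>Y. weight n \<epsilon> x y * f y) \<le> (\<Sum>y\<in>Y. weight n \<epsilon> x y * error n x y)"
    using pos f by (intro sum_mono mult_left_mono) (auto simp: Y_def intro: less_imp_le)
  also have "\<dots> \<le> \<alpha> * ?Z + (32 / (\<epsilon> * n) + 2 * \<delta>)"
    using sum_weight_error_le[OF n m \<epsilon> x \<beta> \<alpha> stable] \<delta> by (simp add: Y_def)
  also have "\<dots> \<le> \<alpha> * ?Z + (32 / (\<epsilon> * n) + 2 * \<delta>) * ?Z"
    using Z mult_left_mono[OF Z nonneg] by simp
  finally have "(\<Sum>y\<in>Y. weight n \<epsilon> x y * f y) / ?Z \<le> \<alpha> + (32 / (\<epsilon> * n) + 2 * \<delta>)"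
    using Z by (simp add: divide_le_eq distrib_right)
  then show ?thesis using expectation_weights_pmf[OF Y Y_ne, of "weight n \<epsilon> x" f] pos by simp
qed

end

section \<open>Choice of parameters and the final theorem\<close>

lemma max_norm_le:
  assumes "finite Q" "Q \<noteq> {}" "\<And>q. q \<in> Q \<Longrightarrow> \<bar>z q\<bar> \<le> c"
  shows "max_norm Q z \<le> c"
  unfolding max_norm_def using assms by (subst Max_le_iff) auto

text \<open>Here \<tau> = ln (2 T), \<kappa> = ln (2 k), E = \<epsilon> n, and \<open>l\<close> is
  the target rate. With \<gamma> = 6 l, the number of rounds makes \<tau> / \<gamma> at most
  \<gamma> m, while \<eta> is set so that \<eta> \<gamma> m = E / 64; \<open>m * \<kappa>\<close> is
  the cost of the union over transcripts.\<close>

lemma parameters: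
  fixes \<tau> \<kappa> E l :: real
  assumes \<tau>: "2/3 \<le> \<tau>" and \<kappa>: "2/3 \<le> \<kappa>" and E: "0 < E"
    and l: "l = sqrt (\<tau> * \<kappa> / E)" "l \<le> 1/129"
  obtains m :: nat and \<eta> :: real where "m \<ge> 1" "0 < \<eta>" "0 < l"
    "\<tau> \<le> m * (6 * l)\<^sup>2" "\<eta> * (6 * l) * m = E / 64" "real m * \<kappa> \<le> E / 18" "1 / E \<le> l / 57"
proof -
  have pos: "0 < \<tau>" "0 < \<kappa>" using \<tau> \<kappa> by auto
  then have l0: "0 < l" using E l(1) by simp
  have l2: "l\<^sup>2 = \<tau> * \<kappa> / E" using pos E by (simp add: l(1))
  have l_sq: "l\<^sup>2 \<le> l / 129" using l(2) l0 by (simp add: power2_eq_square)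
  define m where "m = nat \<lceil>\<tau> / (6 * l)\<^sup>2\<rceil>"
  have quot: "0 < \<tau> / (6 * l)\<^sup>2" using l0 pos by simp
  have m: "\<tau> / (6 * l)\<^sup>2 \<le> m" "m \<le> \<tau> / (6 * l)\<^sup>2 + 1" unfolding m_def using quot by linarith+
  then have m0: "m \<ge> 1" using quot by (cases m) auto
  have le: "\<tau> \<le> m * (6 * l)\<^sup>2" using m(1) l0 by (simp add: divide_le_eq)
  \<comment> \<open>This makes the quotient at least 1, so rounding up to \<open>m\<close> costs at
    most a factor 2.\<close>
  have "(6 * l)\<^sup>2 \<le> \<tau>"
  proof -
    have "(6 * l)\<^sup>2 = 36 * l\<^sup>2" by (simp add: power_mult_distrib)
    then show ?thesis using l_sq l(2) \<tau> by linarith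
  qed
  then have "1 \<le> \<tau> / (6 * l)\<^sup>2" using l0 by (simp add: le_divide_eq)
  then have "m \<le> 2 * (\<tau> / (6 * l)\<^sup>2)" using m(2) by linarith
  then have "real m * \<kappa> \<le> 2 * (\<tau> / (6 * l)\<^sup>2) * \<kappa>" using pos by (intro mult_right_mono) auto
  also have "\<dots> = 2 * (\<tau> * \<kappa>) / (36 * l\<^sup>2)" by (simp add: power_mult_distrib)
  also have "\<dots> = E / 18" using pos E by (simp add: l2)
  finally have m\<kappa>: "real m * \<kappa> \<le> E / 18" .
  have "4/9 \<le> \<tau> * \<kappa>" using mult_mono[OF \<tau> \<kappa>] pos by simp
  then have "1 / E \<le> 9/4 * (\<tau> * \<kappa> / E)" using E by (simp add: field_simps)
  also have "\<dots> = 9/4 * l\<^sup>2" by (simp add: l2)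
  also have "\<dots> \<le> l / 57" using l_sq l0 by linarith
  finally have E_le: "1 / E \<le> l / 57" .
  show ?thesis
    by (rule that[of m "E / (64 * (6 * l) * m)"]) (use m0 l0 le m\<kappa> E_le E in auto)
qed

theorem theorem1p1:
  fixes D :: "'a set" and Q :: "('a \<Rightarrow> real) set" and n T k :: nat and \<epsilon> :: real
  assumes "finite D" and "T = card D" and "T \<ge> 1"
    and "finite Q" and "Q \<noteq> {}" and "k = card Q" and "k \<ge> 1"
    and "n \<ge> 1"
    and "\<And>q. q \<in> Q \<Longrightarrow> q \<in> D \<rightarrow> {-1..1}"
    and "\<epsilon> > 0"
  shows "\<exists>M :: (nat \<Rightarrow> 'a) \<Rightarrow> (('a \<Rightarrow> real) \<Rightarrow> real) pmf.
    randomized_mechanism n D (vectors Q) M \<and>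
    pure_differentially_private \<epsilon> n D (vectors Q) M \<and>
    (SUP x\<in>databases n D.
       measure_pmf.expectation (M x) (\<lambda>z. max_norm Q (\<lambda>q. z q - query_answers n Q x q)))
    \<le> 129 * exp 1 * min 1 (sqrt (ln (2 * real T) * ln (2 * real k) / (\<epsilon> * real n)))"
proof -
  define l where "l = sqrt (ln (2 * real T) * ln (2 * real k) / (\<epsilon> * real n))"
  have D_ne: "D \<noteq> {}" using assms(2,3) by auto
  then have db_ne: "databases n D \<noteq> {}" by (simp add: databases_def PiE_eq_empty_iff)
  have e: "1 \<le> exp (1::real)" by simp
  show ?thesis
  proof (cases "l \<le> 1/129")
    \<comment> \<open>The claimed bound is then at least 1, which the constant answer zero
      achieves.\<close>
    case False
    have "(1::real) = 129 * 1 * (1/129)" by simp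
    also have "\<dots> \<le> 129 * exp 1 * min 1 l" using False e by (intro mult_mono) auto
    finally have bound: "1 \<le> 129 * exp 1 * min 1 l" .
    have mean: "\<bar>query_mean n q x\<bar> \<le> 1" if "q \<in> Q" "x \<in> databases n D" for q x
    proof -
      have "\<bar>\<Sum>i = 1..n. q (x i)\<bar> \<le> (\<Sum>i = 1..n. 1)"
      proof (intro order_trans[OF sum_abs] sum_mono)
        fix i assume "i \<in> {1..n}"
        then have "x i \<in> D" using that by (auto simp: databases_def)
        then show "\<bar>q (x i)\<bar> \<le> 1" using assms(9)[OF that(1)] by (auto simp: Pi_iff abs_le_iff)
      qed
      then show ?thesis by (simp add: query_mean_def divide_le_eq)
    qed
    let ?M = "\<lambda>x. return_pmf (\<lambda>q\<in>Q. 0) :: (('a \<Rightarrow> real) \<Rightarrow> real) pmf"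
    have "randomized_mechanism n D (vectors Q) ?M"
      by (simp add: randomized_mechanism_def vectors_def)
    moreover have "pure_differentially_private \<epsilon> n D (vectors Q) ?M"
      using assms(10) by (auto simp: pure_differentially_private_def indicator_def)
    moreover have "(SUP x\<in>databases n D.
       measure_pmf.expectation (?M x) (\<lambda>z. max_norm Q (\<lambda>q. z q - query_answers n Q x q))) \<le> 1"
      using mean by (intro cSUP_least db_ne) (auto simp: query_answers_def intro!: max_norm_le assms(4,5))
    ultimately show ?thesis using bound unfolding l_def[symmetric] by (intro exI[of _ ?M]) linarith
  next
    case True
    have ln2: "2/3 \<le> ln (2 * real j)" if "j \<ge> 1" for j :: nat
    proof -
      have "ln 2 \<le> ln (2 * real j)" using that by simp
      then show ?thesis using ln2_ge_two_thirds by linarith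
    qed
    obtain m :: nat and \<eta> :: real where m: "m \<ge> 1" and \<eta>: "0 < \<eta>" and l0: "0 < l"
      and \<tau>m: "ln (2 * real T) \<le> m * (6 * l)\<^sup>2" and \<eta>m: "\<eta> * (6 * l) * m = \<epsilon> * n / 64"
      and \<kappa>m: "real m * ln (2 * real k) \<le> \<epsilon> * n / 18" and E_le: "1 / (\<epsilon> * n) \<le> l / 57"
      using parameters[OF ln2[OF assms(3)] ln2[OF assms(7)] _ l_def True] assms(8,10) by auto
    define J where "J = Q \<union> (\<lambda>q t. - q t) ` Q"
    interpret query_game D J "6 * l" \<eta>
    proof
      fix q t assume "q \<in> J" "t \<in> D"
      then show "\<bar>q t\<bar> \<le> 1" using assms(9) by (fastforce simp: J_def Pi_iff abs_le_iff)
    qed (use assms(1,4,5) D_ne \<eta> l0 True in \<open>auto simp: J_def\<close>)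
    define Y where "Y = {y. set y \<subseteq> J \<and> length y = m}"
    define ans where "ans y = (\<lambda>q\<in>Q. dot q (hyp_sum y) / m)" for y
    \<comment> \<open>Post-processing: \<open>ans\<close> sees only the transcript, so privacy of
      the transcript suffices.\<close>
    define M where "M x = map_pmf ans (weights_pmf Y (weight n \<epsilon> x))" for x
    have Y: "finite Y" unfolding Y_def by (rule finite_lists_length_eq[OF finite_J])
    obtain p where "p \<in> J" using J_ne by auto
    then have "replicate m p \<in> Y" by (simp add: Y_def set_replicate_conv_if)
    then have Y_ne: "Y \<noteq> {}" by auto
    have "randomized_mechanism n D (vectors Q) M"
      unfolding randomized_mechanism_def
    proof (intro ballI conjI)
      fix x assume x: "x \<in> databases n D"
      have "set_pmf (weights_pmf Y (weight n \<epsilon> x)) \<subseteq> Y"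
        by (rule set_weights_pmf[OF Y Y_ne weight_pos[OF x]])
      then show "finite (set_pmf (M x))" by (auto simp: M_def intro: finite_subset[OF _ Y])
      show "set_pmf (M x) \<subseteq> vectors Q" by (auto simp: M_def ans_def vectors_def)
    qed
    moreover have "pure_differentially_private \<epsilon> n D (vectors Q) M"
      unfolding pure_differentially_private_def
    proof (intro ballI impI allI)
      fix x x' E
      assume x: "x \<in> databases n D" "x' \<in> databases n D" and "neighboring n x x'"
      then have "hamming n x x' = 1" "hamming n x' x = 1"
        using hamming_commute[of n x x'] by (auto simp: neighboring_def hamming_def)
      then have "weight n \<epsilon> x y \<le> exp (\<epsilon> / 2) * weight n \<epsilon> x' y"
        "weight n \<epsilon> x' y \<le> exp (\<epsilon> / 2) * weight n \<epsilon> x y" for y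
        using weight_lipschitz[OF x] weight_lipschitz[OF x(2,1)] assms(10) by auto
      from prob_weights_pmf_le[OF Y Y_ne weight_pos[OF x(1)] weight_pos[OF x(2)] this]
      show "measure_pmf.prob (M x) E \<le> exp \<epsilon> * measure_pmf.prob (M x') E"
        by (simp add: M_def)
    qed
    moreover have "(SUP x\<in>databases n D.
       measure_pmf.expectation (M x) (\<lambda>z. max_norm Q (\<lambda>q. z q - query_answers n Q x q)))
      \<le> 129 * exp 1 * min 1 l"
    proof (intro cSUP_least db_ne)
      fix x assume x: "x \<in> databases n D"
      have "real T \<le> 2 * real T" "0 < real T" using assms(3) by auto
      then have "ln (card D) \<le> ln (2 * real T)" unfolding assms(2)[symmetric] by simp
      then have "ln (card D) \<le> m * (6 * l)\<^sup>2" using \<tau>m by simp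
      then have ln_le: "ln (card D) / (6 * l) \<le> 6 * l * m"
        using l0 by (simp add: divide_le_eq power2_eq_square mult_ac)
      \<comment> \<open>With \<beta> = 3 l, half of \<gamma>, both regret terms are at most 12 l m;
        their sum, doubled, is 8 \<gamma> m, and multiplying by \<eta> gives E / 8 with E =
        \<epsilon> n.\<close>
      have stable: "\<eta> * (2 * (ln (card D) / (3 * l) + 3 * l * 4 * m)) \<le> \<epsilon> * n / 8"
      proof -
        have "ln (card D) / (3 * l) = 2 * (ln (card D) / (6 * l))" by simp
        then have "2 * (ln (card D) / (3 * l) + 3 * l * 4 * m) \<le> 8 * (6 * l * m)"
          using ln_le by simp
        then have "\<eta> * (2 * (ln (card D) / (3 * l) + 3 * l * 4 * m)) \<le> \<eta> * (8 * (6 * l * m))"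
          using \<eta> by (intro mult_left_mono) auto
        also have "\<dots> = 8 * (\<eta> * (6 * l) * m)" by simp
        finally show ?thesis unfolding \<eta>m by simp
      qed
      \<comment> \<open>The threshold \<alpha> = 66 l is 11 \<gamma>. Two units of \<gamma> m cover
        the regret, and the other nine leave the exponent - 9 E / 64 with E = \<epsilon> n, which
        beats the union cost E / 18 by at least E / 12.\<close>
      have fail: "real (card J) ^ m * exp (\<eta> * (ln (card D) / (6 * l) + 6 * l * m - m * (66 * l))) \<le> 12 / (\<epsilon> * n)"
      proof -
        have "card J \<le> card Q + card ((\<lambda>q t. - q t) ` Q)" unfolding J_def by (rule card_Un_le)
        also have "\<dots> \<le> 2 * k" using card_image_le[OF assms(4), of "\<lambda>q t. - q t"] assms(6) by simp
        finally have "real (card J) \<le> exp (ln (2 * real k))" using assms(7) by simp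
        then have "real (card J) ^ m \<le> exp (ln (2 * real k)) ^ m" by (intro power_mono) auto
        also have "\<dots> = exp (m * ln (2 * real k))" by (simp add: exp_of_nat_mult)
        also have "\<dots> \<le> exp (\<epsilon> * n / 18)" using \<kappa>m by simp
        finally have J: "real (card J) ^ m \<le> exp (\<epsilon> * n / 18)" .
        have "\<eta> * (ln (card D) / (6 * l) + 6 * l * m - m * (66 * l)) \<le> \<eta> * (- 9 * (6 * l * m))"
          using ln_le \<eta> by (intro mult_left_mono) auto
        also have "\<dots> = - 9 * (\<eta> * (6 * l) * m)" by simp
        also have "\<dots> = - 9/64 * (\<epsilon> * n)" unfolding \<eta>m by simp
        finally have "real (card J) ^ m * exp (\<eta> * (ln (card D) / (6 * l) + 6 * l * m - m * (66 * l)))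
          \<le> exp (\<epsilon> * n / 18) * exp (- 9/64 * (\<epsilon> * n))" using J by (intro mult_mono) auto
        also have "\<dots> \<le> exp (- (\<epsilon> * n / 12))" using assms(10) by (simp add: exp_add[symmetric])
        also have "\<dots> \<le> 1 / (\<epsilon> * n / 12)"
        proof -
          have "\<epsilon> * n / 12 \<le> exp (\<epsilon> * n / 12)" using exp_ge_add_one_self[of "\<epsilon> * n / 12"] by linarith
          then have "1 / exp (\<epsilon> * n / 12) \<le> 1 / (\<epsilon> * n / 12)"
            using assms(8,10) by (intro divide_left_mono) auto
          then show ?thesis by (simp add: exp_minus inverse_eq_divide)
        qed
        finally show ?thesis by simp
      qed
      have err: "max_norm Q (\<lambda>q. ans y q - query_answers n Q x q) \<le> error n x y"
        if "set y \<subseteq> J" "length y = m" for y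
      proof (rule max_norm_le[OF assms(4,5)])
        fix q assume q: "q \<in> Q"
        have "query_mean n q x - dot q (hyp_sum y) / m \<le> error n x y"
          using error_ge[of q n x y] q that by (simp add: J_def)
        moreover have "query_mean n (\<lambda>t. - q t) x - dot (\<lambda>t. - q t) (hyp_sum y) / m \<le> error n x y"
          using error_ge[of "\<lambda>t. - q t" n x y] q that by (simp add: J_def)
        ultimately show "\<bar>ans y q - query_answers n Q x q\<bar> \<le> error n x y"
          using q by (simp add: ans_def query_answers_def dot_uminus query_mean_def sum_negf abs_le_iff)
      qed
      have "measure_pmf.expectation (M x) (\<lambda>z. max_norm Q (\<lambda>q. z q - query_answers n Q x q))
        \<le> 66 * l + (32 / (\<epsilon> * n) + 2 * (12 / (\<epsilon> * n)))"
        unfolding M_def integral_map_pmf Y_def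
        by (rule expectation_error_le[OF assms(8) m assms(10) x _ _ _ stable fail err])
          (use l0 True in auto)
      \<comment> \<open>Since 1 / (\<epsilon> n) \<le> l / 57, the total stays below 67 l.\<close>
      also have "\<dots> = 66 * l + 56 * (1 / (\<epsilon> * n))" by simp
      also have "\<dots> \<le> 129 * 1 * l" using E_le l0 by linarith
      also have "\<dots> \<le> 129 * exp 1 * l" using l0 by (intro mult_right_mono mult_left_mono e) auto
      finally show "measure_pmf.expectation (M x) (\<lambda>z. max_norm Q (\<lambda>q. z q - query_answers n Q x q))
        \<le> 129 * exp 1 * min 1 l" using True by simp
    qed
    ultimately show ?thesis unfolding l_def by blast
  qed
qed

end
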